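(* Let $G$ be a finite simple connected graph with diameter $d$, and let $k\ge 0$ be an integer. Then $\mu_k(G)=|V(G)|$ if and only if $k\ge d-1$.
   Context: For $X\subseteq V(G)$ and an integer $k\ge 0$, two vertices $u,v\in V(G)$ are called $(X,k)$-visible if there exists a shortest $(u,v)$-path in $G$ having at most $k$ internal vertices that lie in $X$. A set $X\subseteq V(G)$ is a mutual $k$-visible set if every pair of distinct vertices of $X$ is $(X,k)$-visible. The mutual $k$-visibility number $\mu_k(G)$ is the maximum cardinality of a mutual $k$-visible set in $G$. *)

theory Defs
  imports "Graph_Theory.Graph_Theory"
begin

text \<open>
  A finite simple graph is rendered by the locale \<^locale>\<open>graph\<close>: an undirected edge is a pair of
  opposite arcs, so walks and paths and their lengths are those of the undirected graph.
\<close>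

context wf_digraph
begin

text \<open>Distance is the library's shortest-walk cost under unit arc weights.\<close>

definition graph_dist :: "'a \<Rightarrow> 'a \<Rightarrow> ereal" where
  "graph_dist u v = \<mu> (\<lambda>_. 1) u v"

definition diameter :: ereal where
  "diameter = (SUP u\<in>verts G. SUP v\<in>verts G. graph_dist u v)"

definition shortest_apath :: "'a \<Rightarrow> 'b awalk \<Rightarrow> 'a \<Rightarrow> bool" where
  "shortest_apath u p v \<longleftrightarrow> apath u p v \<and> ereal (real (length p)) = graph_dist u v"

definition visible :: "'a set \<Rightarrow> nat \<Rightarrow> 'a \<Rightarrow> 'a \<Rightarrow> bool" where
  "visible X k u v \<longleftrightarrow>
     (\<exists>p. shortest_apath u p v \<and> card (set (inner_verts p) \<inter> X) \<le> k)"

definition mutual_visible_set :: "nat \<Rightarrow> 'a set \<Rightarrow> bool" where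
  "mutual_visible_set k X \<longleftrightarrow>
     X \<subseteq> verts G \<and> (\<forall>u\<in>X. \<forall>v\<in>X. u \<noteq> v \<longrightarrow> visible X k u v)"

definition mutual_visibility_number :: "nat \<Rightarrow> nat" where
  "mutual_visibility_number k = Max (card ` {X. mutual_visible_set k X})"

end

end

theory Submission
  imports Defs
begin

text \<open>
  A mutual \<open>k\<close>-visible set has full cardinality only if it is the whole vertex set. Relative to the
  whole vertex set, every internal vertex of a path counts, and a path of length \<open>n\<close> has \<open>n - 1\<close> of
  them; hence \<open>u\<close> and \<open>v\<close> are visible exactly when their distance is at most \<open>k + 1\<close>.
\<close>

text \<open>Inner vertices form a middle segment of the vertex list, which is distinct on a path;
  being tails of arcs, they lie in the graph. Truncated subtraction covers the empty path.\<close>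

lemma (in wf_digraph) card_inner_verts_apath:
  assumes "apath u p v"
  shows "card (set (inner_verts p) \<inter> verts G) = length p - 1"
proof -
  have "distinct (inner_verts p)"
    using assms by (simp add: inner_verts_conv[of p u] apath_def distinct_butlast distinct_tl)
  moreover have "set (inner_verts p) \<subseteq> verts G"
    using assms by (auto simp: inner_verts_def apath_def awalk_def subset_iff dest!: list_set_tl)
  ultimately show ?thesis
    by (simp add: Int_absorb2 distinct_card inner_verts_def)
qed

lemma (in wf_digraph) awalk_cost_unit: "awalk_cost (\<lambda>_. 1) p = real (length p)"
  by (induction p) auto

lemma (in wf_digraph) graph_dist_refl_le:
  assumes "u \<in> verts G"
  shows "graph_dist u u \<le> 0"
  using min_cost_le_walk_cost[of u "[]" u "\<lambda>_. 1"] assms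
  by (simp add: graph_dist_def awalk_Nil_iff zero_ereal_def)

lemma (in fin_digraph) shortest_apath_exists:
  assumes "u \<rightarrow>\<^sup>* v"
  obtains p where "shortest_apath u p v"
  using min_cost_awalk[OF assms, of "\<lambda>_. 1"]
  by (auto simp: shortest_apath_def graph_dist_def awalk_cost_unit)

text \<open>All shortest paths from \<open>u\<close> to \<open>v\<close> have the same length, so
  the choice of path is immaterial; reachability supplies one.\<close>

lemma (in fin_digraph) visible_verts_iff:
  assumes "u \<rightarrow>\<^sup>* v"
  shows "visible (verts G) k u v \<longleftrightarrow> graph_dist u v \<le> ereal (real k) + 1"
proof -
  have iff: "card (set (inner_verts p) \<inter> verts G) \<le> k \<longleftrightarrow> graph_dist u v \<le> ereal (real k) + 1"
    if "shortest_apath u p v" for p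
  proof -
    have "graph_dist u v = ereal (real (length p))"
      using that by (simp add: shortest_apath_def)
    then show ?thesis
      using that by (auto simp: shortest_apath_def card_inner_verts_apath one_ereal_def)
  qed
  then show ?thesis
    unfolding visible_def using shortest_apath_exists[OF assms] by metis
qed

lemma (in fin_digraph) mutual_visible_set_verts_iff:
  assumes "strongly_connected G"
  shows "mutual_visible_set k (verts G) \<longleftrightarrow> diameter \<le> ereal (real k) + 1"
proof -
  have "visible (verts G) k u v \<longleftrightarrow> graph_dist u v \<le> ereal (real k) + 1"
    if "u \<in> verts G" "v \<in> verts G" for u v
    using assms that by (intro visible_verts_iff) auto
  \<comment> \<open>The supremum in \<open>diameter\<close> includes the diagonal, whereas mutual
    visibility only tests distinct pairs.\<close>
  moreover have "graph_dist u u \<le> ereal (real k) + 1" if "u \<in> verts G" for u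
    using graph_dist_refl_le[OF that] by (rule order_trans) (simp add: one_ereal_def)
  ultimately show ?thesis
    unfolding mutual_visible_set_def diameter_def SUP_le_iff by fastforce
qed

text \<open>In a finite vertex set, the only subset of full cardinality is the whole set.\<close>

lemma (in fin_digraph) mutual_visibility_number_eq_card_verts_iff:
  "mutual_visibility_number k = card (verts G) \<longleftrightarrow> mutual_visible_set k (verts G)"
proof -
  let ?S = "{X. mutual_visible_set k X}"
  have sub: "X \<subseteq> verts G" if "X \<in> ?S" for X
    using that by (simp add: mutual_visible_set_def)
  then have fin: "finite (card ` ?S)"
    by (intro finite_imageI finite_subset[of ?S "Pow (verts G)"]) auto
  \<comment> \<open>The empty set is vacuously mutual \<open>k\<close>-visible.\<close>
  have ne: "card ` ?S \<noteq> {}"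
    by (auto simp: mutual_visible_set_def)
  have bound: "n \<le> card (verts G)" if "n \<in> card ` ?S" for n
    using that sub by (auto intro!: card_mono)
  \<comment> \<open>An upper bound of a finite nonempty set is its maximum exactly when it is
    attained.\<close>
  have "mutual_visibility_number k = card (verts G) \<longleftrightarrow> card (verts G) \<in> card ` ?S"
    unfolding mutual_visibility_number_def Max_eq_iff[OF fin ne] using bound by blast
  also have "\<dots> \<longleftrightarrow> mutual_visible_set k (verts G)"
    using sub card_subset_eq[OF finite_verts] by (auto simp: image_iff) metis
  finally show ?thesis .
qed

theorem theorem3p8:
  fixes G :: "('a, 'b) pre_digraph" and k :: nat
  assumes "graph G" and "Digraph_Component.connected G"
  shows "wf_digraph.mutual_visibility_number G k = card (verts G)
           \<longleftrightarrow> ereal (real k) \<ge> wf_digraph.diameter G - 1"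
proof -
  interpret graph G by fact
  \<comment> \<open>Connectedness concerns the symmetric closure; since arcs come in opposite pairs,
    it yields directed reachability.\<close>
  have "strongly_connected G"
    using assms(2) symmetric_connected_imp_strongly_connected sym_arcs by blast
  then show ?thesis
    by (simp add: mutual_visibility_number_eq_card_verts_iff mutual_visible_set_verts_iff
        ereal_minus_le_iff add.commute)
qed

end
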